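(* Consider the EMOMA data structure described in the context, after an arbitrary sequence of insertion and removal operations performed by the EMOMA procedures. If every element currently in the set has either been placed successfully in the external cuckoo hash table or lies in the stash, then every search operation on the EMOMA structure is completed with one external memory access: for any key $x$, the search procedure reads at most one bucket of the external table, and it returns the value associated with $x$ whenever $x$ is stored in the structure.
   Context: EMOMA ("Exact Match in One Memory Access") is a dictionary storing key–value pairs $(x,v_x)$ (the key $x$ is called an element). It consists of three parts. (1) A cuckoo hash table in external (off-chip) memory: a single array of buckets, each holding up to 4 elements, with two hash functions $h_1,h_2$; each stored element $x$ resides in bucket $h_1(x)$ or bucket $h_2(x)$. Reading one bucket is one external memory access. (2) A counting block Bloom filter (CBBF): an array of blocks of bits (with associated counters), using $h_1$ as its block selection function and $k$ bit-selection hash functions $g_1,\dots,g_k$ within a block. Inserting $y$ into the CBBF increments the counters at positions $g_1(y),\dots,g_k(y)$ in block $h_1(y)$ (setting the corresponding bits to 1); removing $y$ decrements them, clearing a bit when its counter reaches $0$. An element $z$ is "positive" on the CBBF if all bits $g_1(z),\dots,g_k(z)$ of block $h_1(z)$ are 1, and "negative" otherwise. The CBBF contains exactly the elements currently stored in the table at their second bucket $h_2$. (3) A small stash holding elements pending insertion or that failed insertion. Search for $x$: if $x$ is in the stash, return its value; otherwise query the CBBF; on a negative response read bucket $h_1(x)$, on a positive response read bucket $h_2(x)$; return $v_x$ if $x$ is found in the read bucket and a null value otherwise. Insertion of $x$: $x$ is first placed in the stash; then repeatedly (up to a maximum number $t$ of iterations) an element $x$ from the stash is placed in the table as follows. Its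 bucket is chosen by cases: if $x$ is positive on the CBBF, bucket $h_2(x)$; else if bucket $h_1(x)$ has an empty cell, bucket $h_1(x)$; else if bucket $h_2(x)$ has an empty cell and inserting $x$ into the CBBF would make no element stored in bucket $h_1(x)$ via its first hash function become positive, bucket $h_2(x)$; else if inserting $x$ into the CBBF would create such a new positive, bucket $h_1(x)$; else (both buckets full, no new positives) a random one of the two. A cell in the chosen bucket is taken (an empty one if available, otherwise an occupied one whose element is not "locked", i.e. not an element stored at $h_2$ that is positive on the CBBF). Any element $y$ displaced from that cell is moved to the stash and, if it was stored at $h_2(y)$, removed from the CBBF. If $x$ is placed at $h_2(x)$, then $x$ is inserted into the CBBF, and any elements in bucket $h_1(x)$ stored there via their first hash function that become positive on the CBBF are moved to the stash. Elements not placed after $t$ iterations remain in the stash. Removal of $x$: search for $x$ and delete it; if it was stored at $h_2(x)$, also remove it from the CBBF. *)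

theory Defs
  imports Main
begin

text \<open>Since \<open>hash1\<close> also selects the block of the Bloom filter, blocks and buckets share
  the index range \<open>{..<num_buckets}\<close>; \<open>bit_hash P i\<close> is the \<open>i\<close>-th bit selection function,
  \<open>1 \<le> i \<le> num_bit_hashes P\<close>.\<close>

record 'k emoma_params =
  num_buckets :: nat
  block_size :: nat
  num_bit_hashes :: nat
  max_iters :: nat
  hash1 :: "'k \<Rightarrow> nat"
  hash2 :: "'k \<Rightarrow> nat"
  bit_hash :: "nat \<Rightarrow> 'k \<Rightarrow> nat"

definition valid_params :: "'k emoma_params \<Rightarrow> bool" where
  "valid_params P \<longleftrightarrow>
     (\<forall>x. hash1 P x < num_buckets P) \<and>
     (\<forall>x. hash2 P x < num_buckets P) \<and>
     (\<forall>i\<in>{1..num_bit_hashes P}. \<forall>x. bit_hash P i x < block_size P)"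

definition bucket_size :: nat where
  "bucket_size = 4"

text \<open>A cell remembers through which hash function its element was placed. This is redundant
  except when both hash functions agree on the element; the search never looks at it.\<close>

datatype hash_choice = First | Second

datatype ('k, 'v) entry = Entry (ekey: 'k) (evalue: 'v) (via: hash_choice)

fun bucket_of :: "'k emoma_params \<Rightarrow> hash_choice \<Rightarrow> 'k \<Rightarrow> nat" where
  "bucket_of P First x = hash1 P x"
| "bucket_of P Second x = hash2 P x"

type_synonym ('k, 'v) bucket = "nat \<Rightarrow> ('k, 'v) entry option"
type_synonym ('k, 'v) table = "nat \<Rightarrow> ('k, 'v) bucket"
type_synonym counters = "nat \<Rightarrow> nat \<Rightarrow> nat"

record ('k, 'v) emoma_state =
  table :: "('k, 'v) table"
  cbbf :: counters
  stash :: "('k \<times> 'v) list"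

definition empty_state :: "('k, 'v) emoma_state" where
  "empty_state = \<lparr>table = (\<lambda>b c. None), cbbf = (\<lambda>b p. 0), stash = []\<rparr>"


subsection \<open>Counting block Bloom filter\<close>

text \<open>Bit \<open>p\<close> of block \<open>b\<close> is 1 exactly if its counter is nonzero. If several bit selection
  functions agree on an element, the counter is changed once for each of them.\<close>

definition cbbf_bit :: "counters \<Rightarrow> nat \<Rightarrow> nat \<Rightarrow> bool" where
  "cbbf_bit C b p \<longleftrightarrow> C b p > 0"

definition hits :: "'k emoma_params \<Rightarrow> 'k \<Rightarrow> nat \<Rightarrow> nat" where
  "hits P y p = card {i \<in> {1..num_bit_hashes P}. bit_hash P i y = p}"

definition cbbf_insert :: "'k emoma_params \<Rightarrow> 'k \<Rightarrow> counters \<Rightarrow> counters" where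
  "cbbf_insert P y C = C(hash1 P y := (\<lambda>p. C (hash1 P y) p + hits P y p))"

definition cbbf_remove :: "'k emoma_params \<Rightarrow> 'k \<Rightarrow> counters \<Rightarrow> counters" where
  "cbbf_remove P y C = C(hash1 P y := (\<lambda>p. C (hash1 P y) p - hits P y p))"

definition positive :: "'k emoma_params \<Rightarrow> counters \<Rightarrow> 'k \<Rightarrow> bool" where
  "positive P C z \<longleftrightarrow> (\<forall>i\<in>{1..num_bit_hashes P}. cbbf_bit C (hash1 P z) (bit_hash P i z))"

definition becomes_positive :: "'k emoma_params \<Rightarrow> counters \<Rightarrow> 'k \<Rightarrow> 'k \<Rightarrow> bool" where
  "becomes_positive P C x y \<longleftrightarrow> \<not> positive P C y \<and> positive P (cbbf_insert P x C) y"


subsection \<open>Search\<close>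

text \<open>A computation whose only access to the external memory is reading a whole bucket;
  running it also counts the buckets read.\<close>

datatype ('c, 'r) access = Return 'r | Read nat "'c \<Rightarrow> ('c, 'r) access"

primrec run_access :: "(nat \<Rightarrow> 'c) \<Rightarrow> ('c, 'r) access \<Rightarrow> 'r \<times> nat" where
  "run_access T (Return r) = (r, 0)"
| "run_access T (Read b f) = (case run_access T (f (T b)) of (r, n) \<Rightarrow> (r, Suc n))"

datatype location = In_Stash | In_Cell nat nat

definition find_cell :: "('k, 'v) bucket \<Rightarrow> 'k \<Rightarrow> nat option" where
  "find_cell B x = find (\<lambda>c. map_option ekey (B c) = Some x) [0..<bucket_size]"

definition locate ::
  "'k emoma_params \<Rightarrow> ('k \<times> 'v) list \<Rightarrow> counters \<Rightarrow> 'k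
    \<Rightarrow> (('k, 'v) bucket, (location \<times> 'v) option) access" where
  "locate P S C x =
     (case map_of S x of
        Some v \<Rightarrow> Return (Some (In_Stash, v))
      | None \<Rightarrow>
          (let b = (if positive P C x then hash2 P x else hash1 P x)
           in Read b (\<lambda>B. Return
                (case find_cell B x of
                   None \<Rightarrow> None
                 | Some c \<Rightarrow> Some (In_Cell b c, evalue (the (B c)))))))"

definition search_result :: "'k emoma_params \<Rightarrow> ('k, 'v) emoma_state \<Rightarrow> 'k \<Rightarrow> 'v option" where
  "search_result P s x =
     map_option snd (fst (run_access (table s) (locate P (stash s) (cbbf s) x)))"

definition search_reads :: "'k emoma_params \<Rightarrow> ('k, 'v) emoma_state \<Rightarrow> 'k \<Rightarrow> nat" where
  "search_reads P s x = snd (run_access (table s) (locate P (stash s) (cbbf s) x))"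


subsection \<open>Removal\<close>

definition set_cell ::
  "('k, 'v) table \<Rightarrow> nat \<Rightarrow> nat \<Rightarrow> ('k, 'v) entry option \<Rightarrow> ('k, 'v) table" where
  "set_cell T b c e = T(b := (T b)(c := e))"

fun cbbf_drop_entry ::
  "'k emoma_params \<Rightarrow> ('k, 'v) entry option \<Rightarrow> counters \<Rightarrow> counters" where
  "cbbf_drop_entry P (Some (Entry y v Second)) C = cbbf_remove P y C"
| "cbbf_drop_entry P (Some (Entry y v First)) C = C"
| "cbbf_drop_entry P None C = C"

definition remove :: "'k emoma_params \<Rightarrow> 'k \<Rightarrow> ('k, 'v) emoma_state \<Rightarrow> ('k, 'v) emoma_state" where
  "remove P x s =
     (case fst (run_access (table s) (locate P (stash s) (cbbf s) x)) of
        None \<Rightarrow> s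
      | Some (In_Stash, v) \<Rightarrow> s\<lparr>stash := remove1 (x, v) (stash s)\<rparr>
      | Some (In_Cell b c, v) \<Rightarrow>
          s\<lparr>table := set_cell (table s) b c None,
            cbbf := cbbf_drop_entry P (table s b c) (cbbf s)\<rparr>)"


subsection \<open>Insertion\<close>

definition has_empty_cell :: "('k, 'v) bucket \<Rightarrow> bool" where
  "has_empty_cell B \<longleftrightarrow> (\<exists>c<bucket_size. B c = None)"

definition creates_positive :: "'k emoma_params \<Rightarrow> ('k, 'v) emoma_state \<Rightarrow> 'k \<Rightarrow> bool" where
  "creates_positive P s x \<longleftrightarrow>
     (\<exists>c<bucket_size. \<exists>y v. table s (hash1 P x) c = Some (Entry y v First) \<and>
        becomes_positive P (cbbf s) x y)"

text \<open>A relation rather than a function because of the random choice in the last case.\<close>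

definition bucket_choice ::
  "'k emoma_params \<Rightarrow> ('k, 'v) emoma_state \<Rightarrow> 'k \<Rightarrow> hash_choice \<Rightarrow> bool" where
  "bucket_choice P s x w \<longleftrightarrow>
     (if positive P (cbbf s) x then w = Second
      else if has_empty_cell (table s (hash1 P x)) then w = First
      else if has_empty_cell (table s (hash2 P x)) \<and> \<not> creates_positive P s x then w = Second
      else if creates_positive P s x then w = First
      else True)"

definition locked :: "'k emoma_params \<Rightarrow> counters \<Rightarrow> ('k, 'v) entry \<Rightarrow> bool" where
  "locked P C e \<longleftrightarrow> via e = Second \<and> positive P C (ekey e)"

definition cell_choice :: "'k emoma_params \<Rightarrow> ('k, 'v) emoma_state \<Rightarrow> nat \<Rightarrow> nat \<Rightarrow> bool" where
  "cell_choice P s b c \<longleftrightarrow> c < bucket_size \<and>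
     (if has_empty_cell (table s b) then table s b c = None
      else (\<exists>e. table s b c = Some e \<and> \<not> locked P (cbbf s) e))"

definition pairs_of :: "('k, 'v) entry option list \<Rightarrow> ('k \<times> 'v) list" where
  "pairs_of es = map (\<lambda>e. (ekey (the e), evalue (the e))) (filter (\<lambda>e. e \<noteq> None) es)"

definition write_cell ::
  "'k emoma_params \<Rightarrow> ('k, 'v) emoma_state \<Rightarrow> 'k \<Rightarrow> 'v \<Rightarrow> hash_choice \<Rightarrow> nat
    \<Rightarrow> ('k, 'v) emoma_state" where
  "write_cell P s x v w c =
     (let b = bucket_of P w x; old = table s b c
      in \<lparr>table = set_cell (table s) b c (Some (Entry x v w)),
          cbbf = cbbf_drop_entry P old (cbbf s),
          stash = pairs_of [old] @ remove1 (x, v) (stash s)\<rparr>)"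

definition insert_and_evict ::
  "'k emoma_params \<Rightarrow> 'k \<Rightarrow> ('k, 'v) emoma_state \<Rightarrow> ('k, 'v) emoma_state" where
  "insert_and_evict P x s =
     (let B = table s (hash1 P x);
          evicted = (\<lambda>c. c < bucket_size \<and>
            (\<exists>y v. B c = Some (Entry y v First) \<and> becomes_positive P (cbbf s) x y))
      in \<lparr>table = (table s)(hash1 P x := (\<lambda>c. if evicted c then None else B c)),
          cbbf = cbbf_insert P x (cbbf s),
          stash = pairs_of (map B (filter evicted [0..<bucket_size])) @ stash s\<rparr>)"

definition place ::
  "'k emoma_params \<Rightarrow> ('k, 'v) emoma_state \<Rightarrow> 'k \<Rightarrow> 'v \<Rightarrow> hash_choice \<Rightarrow> nat
    \<Rightarrow> ('k, 'v) emoma_state" where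
  "place P s x v w c =
     (case w of
        First \<Rightarrow> write_cell P s x v First c
      | Second \<Rightarrow> insert_and_evict P x (write_cell P s x v Second c))"

text \<open>If all cells of the chosen bucket are locked, the iteration is spent without effect.\<close>

inductive iteration ::
  "'k emoma_params \<Rightarrow> ('k, 'v) emoma_state \<Rightarrow> ('k, 'v) emoma_state \<Rightarrow> bool" for P where
  placed: "\<lbrakk>(x, v) \<in> set (stash s); bucket_choice P s x w; cell_choice P s (bucket_of P w x) c\<rbrakk>
    \<Longrightarrow> iteration P s (place P s x v w c)"
| all_locked: "\<lbrakk>(x, v) \<in> set (stash s); bucket_choice P s x w;
      \<not> (\<exists>c. cell_choice P s (bucket_of P w x) c)\<rbrakk>
    \<Longrightarrow> iteration P s s"

inductive iterations ::
  "'k emoma_params \<Rightarrow> nat \<Rightarrow> ('k, 'v) emoma_state \<Rightarrow> ('k, 'v) emoma_state \<Rightarrow> bool" for P where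
  exhausted: "iterations P 0 s s"
| stash_empty: "stash s = [] \<Longrightarrow> iterations P n s s"
| iterate: "iteration P s s' \<Longrightarrow> iterations P n s' s'' \<Longrightarrow> iterations P (Suc n) s s''"


subsection \<open>Sequences of operations\<close>

datatype ('k, 'v) operation = Insert 'k 'v | Remove 'k

fun perform ::
  "'k emoma_params \<Rightarrow> ('k, 'v) operation \<Rightarrow> ('k, 'v) emoma_state \<Rightarrow> ('k, 'v) emoma_state \<Rightarrow> bool"
where
  "perform P (Insert x v) s s' \<longleftrightarrow>
     iterations P (max_iters P) (s\<lparr>stash := (x, v) # stash s\<rparr>) s'"
| "perform P (Remove x) s s' \<longleftrightarrow> s' = remove P x s"

inductive performs ::
  "'k emoma_params \<Rightarrow> ('k, 'v) operation list \<Rightarrow> ('k, 'v) emoma_state \<Rightarrow> bool" for P where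
  start: "performs P [] empty_state"
| step: "performs P ops s \<Longrightarrow> perform P op s s' \<Longrightarrow> performs P (ops @ [op]) s'"

fun update_dict :: "('k, 'v) operation \<Rightarrow> ('k \<rightharpoonup> 'v) \<Rightarrow> ('k \<rightharpoonup> 'v)" where
  "update_dict (Insert x v) D = D(x \<mapsto> v)"
| "update_dict (Remove x) D = D(x := None)"

text \<open>The abstract key-value set that the structure is meant to represent.\<close>

definition dict :: "('k, 'v) operation list \<Rightarrow> ('k \<rightharpoonup> 'v)" where
  "dict ops = fold update_dict ops Map.empty"

definition fresh_insertions :: "('k, 'v) operation list \<Rightarrow> bool" where
  "fresh_insertions ops \<longleftrightarrow>
     (\<forall>ops1 x v ops2. ops = ops1 @ Insert x v # ops2 \<longrightarrow> dict ops1 x = None)"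

definition in_table :: "'k emoma_params \<Rightarrow> ('k, 'v) emoma_state \<Rightarrow> 'k \<Rightarrow> 'v \<Rightarrow> bool" where
  "in_table P s x v \<longleftrightarrow>
     (\<exists>b<num_buckets P. \<exists>c<bucket_size. \<exists>w. table s b c = Some (Entry x v w))"

definition in_stash :: "('k, 'v) emoma_state \<Rightarrow> 'k \<Rightarrow> 'v \<Rightarrow> bool" where
  "in_stash s x v \<longleftrightarrow> (x, v) \<in> set (stash s)"

definition stored :: "'k emoma_params \<Rightarrow> ('k, 'v) emoma_state \<Rightarrow> 'k \<Rightarrow> 'v \<Rightarrow> bool" where
  "stored P s x v \<longleftrightarrow> in_table P s x v \<or> in_stash s x v"

end

theory Submission
  imports Defs "HOL-Library.Multiset"
begin

text \<open>The counters of the filter are exactly the sums of the contributions of the elements placed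
  through their second hash function, so these elements are always positive. Conversely, elements
  placed through their first hash function are always negative: such an element can only be turned
  positive by an insertion into its own block, whose index is that of the bucket storing it, and
  that insertion evicts it. Hence the answer of the filter identifies the only bucket that can
  contain a given key. In addition, an iteration only moves pairs between stash and table, so if no
  insertion overwrites a key, then the stored pairs are those of the abstract dictionary.\<close>

section \<open>The invariant and the stored pairs\<close>

text \<open>The codomain is a general monoid so that one sum serves both the filter counters and the
  multiset of stored pairs.\<close>

definition table_sum ::
  "'k emoma_params \<Rightarrow> (('k, 'v) entry option \<Rightarrow> 'a::comm_monoid_add) \<Rightarrow> ('k, 'v) table \<Rightarrow> 'a" where
  "table_sum P f T = (\<Sum>b<num_buckets P. \<Sum>c<bucket_size. f (T b c))"

text \<open>The share of a cell in counter \<open>p\<close> of block \<open>b\<close>. The block is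
  selected by \<open>hash1\<close>, although the entry itself sits in bucket
  \<open>hash2\<close>.\<close>

fun second_hits :: "'k emoma_params \<Rightarrow> nat \<Rightarrow> nat \<Rightarrow> ('k, 'v) entry option \<Rightarrow> nat" where
  "second_hits P b p (Some (Entry y v Second)) = (if hash1 P y = b then hits P y p else 0)"
| "second_hits P b p (Some (Entry y v First)) = 0"
| "second_hits P b p None = 0"

text \<open>A multiset, since multiplicities are what shows that a removal leaves no second pair
  with the same key behind.\<close>

definition contents :: "'k emoma_params \<Rightarrow> ('k, 'v) emoma_state \<Rightarrow> ('k \<times> 'v) multiset" where
  "contents P s = mset (stash s) + table_sum P (\<lambda>e. mset (pairs_of [e])) (table s)"

text \<open>Given valid parameters, the first clause also confines all entries to the cells over
  which \<open>table_sum\<close> ranges.\<close>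

definition well_formed :: "'k emoma_params \<Rightarrow> ('k, 'v) emoma_state \<Rightarrow> bool" where
  "well_formed P s \<longleftrightarrow>
     (\<forall>b c x v w. table s b c = Some (Entry x v w) \<longrightarrow> b = bucket_of P w x \<and> c < bucket_size) \<and>
     (\<forall>b p. cbbf s b p = table_sum P (second_hits P b p) (table s)) \<and>
     (\<forall>b c x v. table s b c = Some (Entry x v First) \<longrightarrow> \<not> positive P (cbbf s) x)"

lemma well_formedI:
  assumes "\<And>b c x v w. table s b c = Some (Entry x v w) \<Longrightarrow> b = bucket_of P w x \<and> c < bucket_size"
    and "\<And>b p. cbbf s b p = table_sum P (second_hits P b p) (table s)"
    and "\<And>b c x v. table s b c = Some (Entry x v First) \<Longrightarrow> \<not> positive P (cbbf s) x"
  shows "well_formed P s"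
  using assms unfolding well_formed_def by blast

lemma well_formed_bucket:
  assumes "well_formed P s" "table s b c = Some (Entry x v w)"
  shows "b = bucket_of P w x" "c < bucket_size"
  using assms unfolding well_formed_def by blast+

lemma well_formed_cbbf:
  "well_formed P s \<Longrightarrow> cbbf s b p = table_sum P (second_hits P b p) (table s)"
  unfolding well_formed_def by blast

lemma well_formed_first:
  "well_formed P s \<Longrightarrow> table s b c = Some (Entry x v First) \<Longrightarrow> \<not> positive P (cbbf s) x"
  unfolding well_formed_def by blast

lemma bucket_of_less: "valid_params P \<Longrightarrow> bucket_of P w x < num_buckets P"
  by (cases w) (auto simp: valid_params_def)

section \<open>Sums over the table under updates\<close>

text \<open>Nothing can be subtracted in a general monoid, so the old bucket is added on the left
  instead.\<close>

lemma table_sum_upd_bucket: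
  assumes "b < num_buckets P"
  shows "table_sum P f (T(b := B)) + (\<Sum>c<bucket_size. f (T b c)) =
    table_sum P f T + (\<Sum>c<bucket_size. f (B c))"
proof -
  have *: "table_sum P f U =
      (\<Sum>c<bucket_size. f (U b c)) + (\<Sum>i\<in>{..<num_buckets P} - {b}. \<Sum>c<bucket_size. f (U i c))" for U
    unfolding table_sum_def using assms by (subst sum.remove[of _ b]) auto
  show ?thesis
    by (simp add: * ac_simps)
qed

lemma table_sum_set_cell:
  fixes f :: "('k, 'v) entry option \<Rightarrow> 'a::cancel_comm_monoid_add"
  assumes "b < num_buckets P" "c < bucket_size"
  shows "table_sum P f (set_cell T b c e) + f (T b c) = table_sum P f T + f e"
proof -
  \<comment> \<open>The cells of the bucket other than \<open>c\<close>; their sum appears on both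
    sides and is cancelled at the end, hence the cancellative codomain.\<close>
  let ?R = "\<Sum>i\<in>{..<bucket_size} - {c}. f (T b i)"
  have "(\<Sum>i<bucket_size. f (T b i)) = f (T b c) + ?R"
    using assms by (subst sum.remove[of _ c]) auto
  moreover have "(\<Sum>i<bucket_size. f (((T b)(c := e)) i)) = f e + ?R"
    using assms by (subst sum.remove[of _ c]) auto
  ultimately have "(table_sum P f (set_cell T b c e) + f (T b c)) + ?R = (table_sum P f T + f e) + ?R"
    using table_sum_upd_bucket[OF assms(1), of f T "(T b)(c := e)"]
    by (simp add: set_cell_def add.assoc)
  then show ?thesis by (simp only: add_right_cancel)
qed

lemma table_sum_ge:
  fixes f :: "('k, 'v) entry option \<Rightarrow> nat"
  assumes "b < num_buckets P" "c < bucket_size"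
  shows "f (T b c) \<le> table_sum P f T"
proof -
  have "f (T b c) \<le> (\<Sum>c<bucket_size. f (T b c))"
    using assms by (intro member_le_sum) auto
  also have "\<dots> \<le> table_sum P f T"
    unfolding table_sum_def using assms
    by (intro member_le_sum[of b _ "\<lambda>b. \<Sum>c<bucket_size. f (T b c)"]) auto
  finally show ?thesis .
qed

section \<open>Counters and positivity\<close>

lemma cbbf_insert_apply:
  "cbbf_insert P x C b p = C b p + (if hash1 P x = b then hits P x p else 0)"
  by (simp add: cbbf_insert_def)

text \<open>One formula covers all three equations, because \<open>second_hits\<close> vanishes on
  empty cells and on entries placed via \<open>First\<close>.\<close>

lemma cbbf_drop_entry_apply: "cbbf_drop_entry P e C b p = C b p - second_hits P b p e"
  by (cases "(P, e, C)" rule: cbbf_drop_entry.cases) (auto simp: cbbf_remove_def)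

lemma positive_mono:
  assumes "positive P C x" "\<And>p. C (hash1 P x) p \<le> C' (hash1 P x) p"
  shows "positive P C' x"
  using assms unfolding positive_def cbbf_bit_def by (meson less_le_trans)

text \<open>The filter has no false negatives: at each of the bits of \<open>x\<close>, the entry of
  \<open>x\<close> alone already contributes a nonzero share to the counter.\<close>

lemma second_positive:
  assumes "valid_params P" "well_formed P s" "table s b c = Some (Entry x v Second)"
  shows "positive P (cbbf s) x"
  unfolding positive_def cbbf_bit_def
proof
  fix i assume i: "i \<in> {1..num_bit_hashes P}"
  let ?p = "bit_hash P i x"
  have "0 < hits P x ?p"
    unfolding hits_def card_gt_0_iff using i by auto
  also have "hits P x ?p = second_hits P (hash1 P x) ?p (table s b c)"
    using assms(3) by simp
  also have "\<dots> \<le> table_sum P (second_hits P (hash1 P x) ?p) (table s)"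
    using well_formed_bucket[OF assms(2,3)] bucket_of_less[OF assms(1), of Second x]
    by (intro table_sum_ge) auto
  also have "\<dots> = cbbf s (hash1 P x) ?p"
    using well_formed_cbbf[OF assms(2)] by simp
  finally show "0 < cbbf s (hash1 P x) ?p" .
qed

section \<open>Search\<close>

lemma find_cell_Some:
  assumes "find_cell B x = Some c"
  shows "c < bucket_size" "\<exists>v w. B c = Some (Entry x v w)"
proof -
  have "c < bucket_size" "map_option ekey (B c) = Some x"
    using assms unfolding find_cell_def by (auto simp: find_Some_iff)
  then show "c < bucket_size" "\<exists>v w. B c = Some (Entry x v w)"
    by (auto, metis entry.exhaust_sel)
qed

lemma find_cell_complete:
  assumes "B c = Some (Entry x v w)" "c < bucket_size"
  shows "find_cell B x \<noteq> None"
  using assms unfolding find_cell_def find_None_iff by force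

lemma search_reads_le_1: "search_reads P s x \<le> 1"
  unfolding search_reads_def locate_def by (auto simp: Let_def split: option.split)

text \<open>Serves search and removal alike, since both run \<open>locate\<close>.\<close>

lemma locate_sound:
  assumes "valid_params P" "fst (run_access (table s) (locate P (stash s) (cbbf s) x)) = Some (l, v)"
  shows "(l = In_Stash \<and> in_stash s x v) \<or>
    (\<exists>b c w. l = In_Cell b c \<and> b < num_buckets P \<and> c < bucket_size \<and>
      table s b c = Some (Entry x v w))"
proof (cases "map_of (stash s) x")
  case (Some u)
  then show ?thesis
    using assms(2) map_of_SomeD[OF Some] by (simp add: locate_def in_stash_def)
next
  case None
  let ?b = "if positive P (cbbf s) x then hash2 P x else hash1 P x"
  obtain c where c: "find_cell (table s ?b) x = Some c" "l = In_Cell ?b c"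
    "v = evalue (the (table s ?b c))"
    using assms(2) None by (simp add: locate_def Let_def split: option.splits)
  moreover have "?b < num_buckets P"
    using assms(1) by (simp add: valid_params_def)
  ultimately show ?thesis
    using find_cell_Some[OF c(1)] by auto
qed

text \<open>Entries placed via \<open>Second\<close> are positive and those via \<open>First\<close>
  negative, so the filter sends the search to the bucket that holds \<open>x\<close>. The value
  found may differ from \<open>u\<close> when several pairs share the key.\<close>

lemma locate_complete:
  assumes "valid_params P" "well_formed P s" "stored P s x u"
  shows "fst (run_access (table s) (locate P (stash s) (cbbf s) x)) \<noteq> None"
proof (cases "map_of (stash s) x")
  case None
  then have "\<not> in_stash s x u"
    unfolding in_stash_def by (metis weak_map_of_SomeI option.distinct(1))
  then obtain b c w where e: "table s b c = Some (Entry x u w)"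
    using assms(3) unfolding stored_def in_table_def by blast
  have "b = (if positive P (cbbf s) x then hash2 P x else hash1 P x)"
    using well_formed_bucket(1)[OF assms(2) e] e
      second_positive[OF assms(1,2)] well_formed_first[OF assms(2)]
    by (cases w) auto
  moreover have "find_cell (table s b) x \<noteq> None"
    using e well_formed_bucket(2)[OF assms(2) e] by (rule find_cell_complete)
  ultimately show ?thesis
    using None by (auto simp: locate_def Let_def)
qed (simp add: locate_def)

lemma search_result_stored:
  assumes "valid_params P" "well_formed P s" "stored P s x u"
  shows "\<exists>v. stored P s x v \<and> search_result P s x = Some v"
proof -
  obtain l v where lv: "fst (run_access (table s) (locate P (stash s) (cbbf s) x)) = Some (l, v)"
    using locate_complete[OF assms] by auto
  then have "stored P s x v"
    using locate_sound[OF assms(1) lv] unfolding stored_def in_table_def by blast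
  with lv show ?thesis
    by (simp add: search_result_def)
qed

text \<open>Lets multiplicities decide what is stored.\<close>

lemma stored_iff_contents: "stored P s x v \<longleftrightarrow> (x, v) \<in># contents P s"
proof -
  have "(x, v) \<in># mset (pairs_of [e]) \<longleftrightarrow> (\<exists>w. e = Some (Entry x v w))" for e
    by (cases e) (auto simp: pairs_of_def, metis entry.exhaust_sel)
  then show ?thesis
    unfolding stored_def in_table_def in_stash_def contents_def table_sum_def
    by (fastforce simp: set_mset_sum)
qed

section \<open>Removal\<close>

text \<open>Counters only decrease, so negative elements stay negative, and the filter gives up
  exactly the share of the deleted cell.\<close>

lemma well_formed_remove:
  assumes "valid_params P" "well_formed P s"
  shows "well_formed P (remove P x s)"
proof (cases "fst (run_access (table s) (locate P (stash s) (cbbf s) x))")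
  case None
  then show ?thesis using assms(2) by (simp add: remove_def)
next
  case (Some a)
  then obtain l v where a: "fst (run_access (table s) (locate P (stash s) (cbbf s) x)) = Some (l, v)"
    by (cases a) auto
  from locate_sound[OF assms(1) a] show ?thesis
  proof (elim disjE exE conjE)
    assume "l = In_Stash"
    then show ?thesis
      using assms(2) a by (simp add: remove_def well_formed_def)
  next
    fix b c w
    assume l: "l = In_Cell b c" and bc: "b < num_buckets P" "c < bucket_size"
      and e: "table s b c = Some (Entry x v w)"
    let ?s = "remove P x s"
    have T: "table ?s = set_cell (table s) b c None"
      and C: "cbbf ?s = cbbf_drop_entry P (table s b c) (cbbf s)"
      using a l by (simp_all add: remove_def)
    have sub: "table s b' c' = Some e'" if "table ?s b' c' = Some e'" for b' c' e'
      using that unfolding T set_cell_def by (auto split: if_splits)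
    show ?thesis
    proof (rule well_formedI)
      fix b' p
      \<comment> \<open>By the invariant the deleted share is a summand of the counter, so the
        truncated subtraction is exact.\<close>
      show "cbbf ?s b' p = table_sum P (second_hits P b' p) (table ?s)"
        unfolding T C cbbf_drop_entry_apply well_formed_cbbf[OF assms(2)]
        using table_sum_set_cell[OF bc, of "second_hits P b' p" "table s" None] by simp
    next
      fix b' c' y u assume "table ?s b' c' = Some (Entry y u First)"
      then have "\<not> positive P (cbbf s) y"
        using sub well_formed_first[OF assms(2)] by blast
      then show "\<not> positive P (cbbf ?s) y"
        using positive_mono[of P "cbbf ?s" y "cbbf s"] by (auto simp: C cbbf_drop_entry_apply)
    qed (use sub well_formed_bucket[OF assms(2)] in blast)
  qed
qed

text \<open>A search that fails proves absence by \<open>locate_complete\<close>; one that succeeds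
  deletes a single pair, whose value is not fixed because a key may occur with several.\<close>

lemma contents_remove:
  assumes "valid_params P" "well_formed P s"
  shows "(\<nexists>u. stored P s x u) \<and> contents P (remove P x s) = contents P s \<or>
    (\<exists>v. contents P s = add_mset (x, v) (contents P (remove P x s)))"
proof (cases "fst (run_access (table s) (locate P (stash s) (cbbf s) x))")
  case None
  then show ?thesis
    using locate_complete[OF assms, of x] by (auto simp: remove_def)
next
  case (Some a)
  then obtain l v where a: "fst (run_access (table s) (locate P (stash s) (cbbf s) x)) = Some (l, v)"
    by (cases a) auto
  from locate_sound[OF assms(1) a] have "contents P s = add_mset (x, v) (contents P (remove P x s))"
  proof (elim disjE exE conjE)
    assume "l = In_Stash" "in_stash s x v"
    then show ?thesis
      using a by (simp add: remove_def contents_def in_stash_def)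
  next
    fix b c w
    assume l: "l = In_Cell b c" and bc: "b < num_buckets P" "c < bucket_size"
      and e: "table s b c = Some (Entry x v w)"
    then show ?thesis
      using a table_sum_set_cell[OF bc, of "\<lambda>e. mset (pairs_of [e])" "table s" None]
      by (simp add: remove_def contents_def pairs_of_def)
  qed
  then show ?thesis by blast
qed

section \<open>Placing an element\<close>

text \<open>Elements placed through their second hash function are always positive, hence locked.\<close>

lemma cell_choice_cases:
  assumes "valid_params P" "well_formed P s" "cell_choice P s b c"
  obtains "table s b c = None" | y u where "table s b c = Some (Entry y u First)"
proof (cases "table s b c")
  case (Some e)
  then have "\<not> locked P (cbbf s) e"
    using assms(3) unfolding cell_choice_def by (auto split: if_splits)
  moreover obtain y u w where e: "e = Entry y u w" by (cases e)
  ultimately have "w = First"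
    using second_positive[OF assms(1,2)] Some by (cases w) (auto simp: locked_def)
  with that(2) Some e show ?thesis by blast
qed (use that(1) in blast)

lemma write_cell_simps:
  "table (write_cell P s x v w c) = set_cell (table s) (bucket_of P w x) c (Some (Entry x v w))"
  "cbbf (write_cell P s x v w c) = cbbf_drop_entry P (table s (bucket_of P w x) c) (cbbf s)"
  "stash (write_cell P s x v w c) =
    pairs_of [table s (bucket_of P w x) c] @ remove1 (x, v) (stash s)"
  by (simp_all add: write_cell_def Let_def)

text \<open>The pair leaves the stash as it enters the cell, and a displaced pair goes the opposite
  way.\<close>

lemma contents_write_cell:
  assumes "valid_params P" "c < bucket_size" "(x, v) \<in> set (stash s)"
  shows "contents P (write_cell P s x v w c) = contents P s"
  using table_sum_set_cell[OF bucket_of_less[OF assms(1)] assms(2), of "\<lambda>e. mset (pairs_of [e])"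
      "table s" w x "Some (Entry x v w)"] assms(3)
  by (simp add: contents_def write_cell_simps pairs_of_def ac_simps)

text \<open>Turns the list of evicted pairs into a sum over cells, comparable with
  \<open>table_sum\<close>.\<close>

lemma mset_pairs_of: "mset (pairs_of es) = (\<Sum>e\<leftarrow>es. mset (pairs_of [e]))"
  by (induction es) (auto simp: pairs_of_def)

lemma contents_insert_and_evict:
  assumes "valid_params P"
  shows "contents P (insert_and_evict P x s) = contents P s"
proof -
  let ?f = "\<lambda>e. mset (pairs_of [e])"
  define B where "B = table s (hash1 P x)"
  define ev where "ev = (\<lambda>c. c < bucket_size \<and>
    (\<exists>y v. B c = Some (Entry y v First) \<and> becomes_positive P (cbbf s) x y))"
  define B' where "B' = (\<lambda>c. if ev c then None else B c)"
  have s': "table (insert_and_evict P x s) = (table s)(hash1 P x := B')"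
    "stash (insert_and_evict P x s) = pairs_of (map B (filter ev [0..<bucket_size])) @ stash s"
    by (simp_all add: insert_and_evict_def Let_def B'_def ev_def B_def cong: if_cong)
  have "mset (pairs_of (map B (filter ev [0..<bucket_size]))) =
      (\<Sum>c\<leftarrow>filter ev [0..<bucket_size]. ?f (B c))"
    by (subst mset_pairs_of) (simp add: comp_def)
  also have "\<dots> = (\<Sum>c\<in>{c\<in>{..<bucket_size}. ev c}. ?f (B c))"
    by (subst sum_list_distinct_conv_sum_set) (auto intro: sum.cong)
  also have "\<dots> = (\<Sum>c<bucket_size. if ev c then ?f (B c) else {#})"
    by (rule sum.inter_filter) simp
  finally have evicted: "mset (pairs_of (map B (filter ev [0..<bucket_size]))) =
    (\<Sum>c<bucket_size. if ev c then ?f (B c) else {#})" .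
  \<comment> \<open>Each cell is either evicted or kept, so at least one of the two summands is
    empty.\<close>
  have "(\<Sum>c<bucket_size. ?f (B c)) =
      (\<Sum>c<bucket_size. (if ev c then ?f (B c) else {#}) + ?f (B' c))"
    by (intro sum.cong) (auto simp: B'_def pairs_of_def)
  then have split: "(\<Sum>c<bucket_size. ?f (B c)) =
      (\<Sum>c<bucket_size. if ev c then ?f (B c) else {#}) + (\<Sum>c<bucket_size. ?f (B' c))"
    by (simp add: sum.distrib)
  have "hash1 P x < num_buckets P"
    using assms by (simp add: valid_params_def)
  from table_sum_upd_bucket[OF this, of ?f "table s" B']
  have "table_sum P ?f ((table s)(hash1 P x := B')) +
      mset (pairs_of (map B (filter ev [0..<bucket_size]))) = table_sum P ?f (table s)"
    unfolding evicted B_def[symmetric] split by (simp add: add.assoc[symmetric])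
  then show ?thesis
    unfolding contents_def s' by (simp add: ac_simps)
qed

lemma contents_place:
  assumes "valid_params P" "c < bucket_size" "(x, v) \<in> set (stash s)"
  shows "contents P (place P s x v w c) = contents P s"
  by (cases w) (simp_all add: place_def contents_insert_and_evict contents_write_cell assms)

text \<open>The overwritten cell is empty or holds a \<open>First\<close> entry, so no counter
  changes; the new entry is negative by assumption.\<close>

lemma well_formed_place_First:
  assumes "valid_params P" "well_formed P s" "\<not> positive P (cbbf s) x"
    "cell_choice P s (hash1 P x) c"
  shows "well_formed P (place P s x v First c)"
proof -
  let ?s = "place P s x v First c"
  have c: "c < bucket_size"
    using assms(4) by (simp add: cell_choice_def)
  have old: "second_hits P b p (table s (hash1 P x) c) = 0" for b p
    by (rule cell_choice_cases[OF assms(1,2,4)]) auto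
  have T: "table ?s = set_cell (table s) (hash1 P x) c (Some (Entry x v First))"
    by (simp add: place_def write_cell_simps)
  have C: "cbbf ?s = cbbf s"
    by (intro ext) (simp add: place_def write_cell_simps cbbf_drop_entry_apply old)
  show ?thesis
  proof (rule well_formedI)
    fix b p
    show "cbbf ?s b p = table_sum P (second_hits P b p) (table ?s)"
      using table_sum_set_cell[OF bucket_of_less[OF assms(1), of First x] c,
          of "second_hits P b p" "table s" "Some (Entry x v First)"]
      by (simp add: C T well_formed_cbbf[OF assms(2)] old)
  next
    fix b c' y u w assume "table ?s b c' = Some (Entry y u w)"
    then show "b = bucket_of P w y \<and> c' < bucket_size"
      using well_formed_bucket[OF assms(2)] c
      unfolding T set_cell_def by (auto split: if_splits)
  next
    fix b c' y u assume "table ?s b c' = Some (Entry y u First)"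
    then show "\<not> positive P (cbbf ?s) y"
      using well_formed_first[OF assms(2)] assms(3)
      unfolding T C set_cell_def by (auto split: if_splits)
  qed
qed

text \<open>Inserting \<open>x\<close> can raise counters only in block \<open>hash1 P x\<close>.
  The \<open>First\<close> entries belonging to that block all sit in the bucket of the same index,
  which is the one scanned for eviction.\<close>

lemma well_formed_place_Second:
  assumes "valid_params P" "well_formed P s" "cell_choice P s (hash2 P x) c"
  shows "well_formed P (place P s x v Second c)"
proof -
  let ?s = "place P s x v Second c"
  define T1 where "T1 = set_cell (table s) (hash2 P x) c (Some (Entry x v Second))"
  \<comment> \<open>Eviction is decided on the table \<open>T1\<close> after the write, but
    \<open>cbbf s\<close> is the right filter because the write leaves the counters unchanged, as
    \<open>C1\<close> shows.\<close>
  define ev where "ev = (\<lambda>b c. b = hash1 P x \<and> c < bucket_size \<and>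
    (\<exists>y v. T1 b c = Some (Entry y v First) \<and> becomes_positive P (cbbf s) x y))"
  have c: "c < bucket_size"
    using assms(3) by (simp add: cell_choice_def)
  have old: "second_hits P b p (table s (hash2 P x) c) = 0" for b p
    by (rule cell_choice_cases[OF assms]) auto
  have C1: "cbbf (write_cell P s x v Second c) = cbbf s"
    by (intro ext) (simp add: write_cell_simps cbbf_drop_entry_apply old)
  have T1': "table (write_cell P s x v Second c) = T1"
    by (simp add: write_cell_simps T1_def)
  have T: "table ?s = (\<lambda>b c. if ev b c then None else T1 b c)"
    by (intro ext) (auto simp: place_def insert_and_evict_def Let_def C1 T1' ev_def)
  have C: "cbbf ?s = cbbf_insert P x (cbbf s)"
    by (simp add: place_def insert_and_evict_def Let_def C1)
  show ?thesis
  proof (rule well_formedI)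
    fix b p
    \<comment> \<open>Only \<open>First\<close> entries are evicted, and these have no share in any
      counter.\<close>
    have "second_hits P b p (table ?s b' c') = second_hits P b p (T1 b' c')" for b' c'
      by (auto simp: T ev_def)
    then have "table_sum P (second_hits P b p) (table ?s) = table_sum P (second_hits P b p) T1"
      by (simp add: table_sum_def)
    then show "cbbf ?s b p = table_sum P (second_hits P b p) (table ?s)"
      using table_sum_set_cell[OF bucket_of_less[OF assms(1), of Second x] c,
          of "second_hits P b p" "table s" "Some (Entry x v Second)"]
      by (simp add: C cbbf_insert_apply T1_def well_formed_cbbf[OF assms(2)] old)
  next
    fix b c' y u w assume "table ?s b c' = Some (Entry y u w)"
    then show "b = bucket_of P w y \<and> c' < bucket_size"
      using well_formed_bucket[OF assms(2)] c
      unfolding T T1_def set_cell_def by (auto split: if_splits)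
  next
    fix b c' y u assume e': "table ?s b c' = Some (Entry y u First)"
    then have T1: "T1 b c' = Some (Entry y u First)" and nev: "\<not> ev b c'"
      unfolding T by (auto split: if_splits)
    from T1 have e: "table s b c' = Some (Entry y u First)"
      unfolding T1_def set_cell_def by (auto split: if_splits)
    have b: "b = hash1 P y" "c' < bucket_size" and neg: "\<not> positive P (cbbf s) y"
      using well_formed_bucket[OF assms(2) e] well_formed_first[OF assms(2) e] by simp_all
    show "\<not> positive P (cbbf ?s) y"
    proof (cases "hash1 P y = hash1 P x")
      \<comment> \<open>\<open>y\<close> was negative and was not evicted, so it did not become
        positive.\<close>
      case True
      then show ?thesis
        using nev T1 b neg unfolding C ev_def becomes_positive_def by auto
    next
      \<comment> \<open>The counters in the block of \<open>y\<close> are not touched.\<close>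
      case False
      then show ?thesis
        using neg unfolding C positive_def cbbf_bit_def cbbf_insert_apply by auto
    qed
  qed
qed

section \<open>Iterations and sequences of operations\<close>

lemma iteration_preserves:
  assumes "iteration P s s'" "valid_params P" "well_formed P s"
  shows "well_formed P s' \<and> contents P s' = contents P s"
  using assms(1)
proof cases
  case (placed x v w c)
  have "c < bucket_size"
    using placed(4) by (simp add: cell_choice_def)
  moreover have "well_formed P (place P s x v w c)"
  proof (cases w)
    case First
    \<comment> \<open>A positive \<open>x\<close> would have forced the choice
      \<open>Second\<close>.\<close>
    then have "\<not> positive P (cbbf s) x"
      using placed(3) by (auto simp: bucket_choice_def)
    then show ?thesis
      using First placed(4) assms well_formed_place_First by fastforce
  next
    case Second
    then show ?thesis
      using placed(4) assms well_formed_place_Second by fastforce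
  qed
  ultimately show ?thesis
    using contents_place[OF assms(2)] placed by auto
qed (use assms in simp)

lemma iterations_preserves:
  assumes "iterations P n s s'" "valid_params P" "well_formed P s"
  shows "well_formed P s' \<and> contents P s' = contents P s"
  using assms by induction (auto dest: iteration_preserves)

text \<open>Pushing the pair on the stash is the only change of contents; the iterations merely move
  pairs around, even if they stop before the stash is empty.\<close>

lemma perform_Insert:
  assumes "perform P (Insert x v) s s'" "valid_params P" "well_formed P s"
  shows "well_formed P s' \<and> contents P s' = add_mset (x, v) (contents P s)"
proof -
  let ?s = "s\<lparr>stash := (x, v) # stash s\<rparr>"
  have "well_formed P ?s"
    using assms(3) by (simp add: well_formed_def)
  moreover have "contents P ?s = add_mset (x, v) (contents P s)"
    by (simp add: contents_def)
  ultimately show ?thesis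
    using iterations_preserves[of P "max_iters P" ?s s'] assms by auto
qed

lemma performs_well_formed:
  assumes "performs P ops s" "valid_params P"
  shows "well_formed P s"
  using assms
proof induction
  case start
  show ?case
    by (simp add: well_formed_def empty_state_def table_sum_def)
next
  case (step ops s op s')
  then show ?case
    using perform_Insert well_formed_remove by (cases op) (fastforce simp del: perform.simps(1))+
qed

lemma dict_snoc: "dict (ops @ [op]) = update_dict op (dict ops)"
  by (simp add: dict_def)

text \<open>Multiplicity one, rather than mere membership, is what makes deleting a single pair
  clear the key. Freshness keeps a second pair with the same key from arising.\<close>

lemma performs_count_contents:
  assumes "performs P ops s" "valid_params P" "fresh_insertions ops"
  shows "count (contents P s) (y, u) = (if dict ops y = Some u then 1 else 0)"
  using assms
proof (induction arbitrary: y u)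
  case start
  show ?case
    by (simp add: contents_def empty_state_def table_sum_def dict_def pairs_of_def)
next
  case (step ops s op s')
  have wf: "well_formed P s"
    using performs_well_formed step by blast
  have "fresh_insertions ops"
    using step.prems(2) unfolding fresh_insertions_def by fastforce
  then have IH: "count (contents P s) (y, u) = (if dict ops y = Some u then 1 else 0)" for y u
    using step by blast
  show ?case
  proof (cases op)
    case (Insert x v)
    then have "dict ops x = None"
      using step.prems(2) unfolding fresh_insertions_def by blast
    then show ?thesis
      using perform_Insert[of P x v s s'] step Insert wf
      by (auto simp: dict_snoc IH simp del: perform.simps)
  next
    case (Remove x)
    then have s': "s' = remove P x s"
      using step by simp
    from contents_remove[OF step.prems(1) wf, of x] show ?thesis
    proof (elim disjE exE conjE)
      assume *: "\<nexists>u. stored P s x u" "contents P (remove P x s) = contents P s"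
      then have "dict ops x = None"
        using IH[of x] unfolding stored_iff_contents
        by (metis count_eq_zero_iff option.exhaust zero_neq_one)
      then show ?thesis
        using * by (simp add: s' Remove dict_snoc IH)
    next
      fix v assume *: "contents P s = add_mset (x, v) (contents P (remove P x s))"
      \<comment> \<open>The deleted pair had a positive count, so it must be the pair of the
        dictionary, and no copy of it is left.\<close>
      have "dict ops x = Some v"
        using IH[of x v] * by (auto split: if_splits)
      then show ?thesis
        using IH[of y u] * by (auto simp: s' Remove dict_snoc split: if_splits)
    qed
  qed
qed

text \<open>A key inserted twice may be stored with two values, so the search is tied to some stored
  value in general and to the dictionary value when all insertions are fresh.\<close>

theorem theorem1:
  fixes P :: "'k emoma_params"
    and ops :: "('k, 'v) operation list"
    and s :: "('k, 'v) emoma_state"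
  assumes "valid_params P"
    and "performs P ops s"
    and "\<forall>x v. dict ops x = Some v \<longrightarrow> in_table P s x v \<or> in_stash s x v"
  shows "\<forall>x. search_reads P s x \<le> 1
    \<and> ((\<exists>v. stored P s x v) \<longrightarrow> (\<exists>v. stored P s x v \<and> search_result P s x = Some v))
    \<and> (fresh_insertions ops \<longrightarrow> (\<forall>v. dict ops x = Some v \<longrightarrow> search_result P s x = Some v))"
proof (intro allI conjI impI)
  fix x
  note found = search_result_stored[OF assms(1) performs_well_formed[OF assms(2,1)]]
  show "search_reads P s x \<le> 1"
    by (rule search_reads_le_1)
  show "\<exists>v. stored P s x v \<and> search_result P s x = Some v" if "\<exists>v. stored P s x v"
    using that found by blast
  show "search_result P s x = Some v" if "fresh_insertions ops" "dict ops x = Some v" for v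
  proof -
    have "stored P s x v"
      using assms(3) that(2) unfolding stored_def by blast
    then obtain u where u: "stored P s x u" "search_result P s x = Some u"
      using found by blast
    \<comment> \<open>The pair found has a nonzero count, which forces it to agree with the
      dictionary.\<close>
    then have "dict ops x = Some u"
      using performs_count_contents[OF assms(2,1) that(1), of x u]
      unfolding stored_iff_contents by (metis count_eq_zero_iff)
    with u that(2) show ?thesis by simp
  qed
qed

end
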